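(* Let $r=[m_1,m_2,\dots,m_k]$ be a rational number with $0<r\le1$. The cyclic sequence $CS(r)$ has a decomposition $(\!(S_1,S_2,S_1,S_2)\!)$ which satisfies the following. (1) Each $S_i$ is symmetric, that is, the sequence obtained from $S_i$ by reversing the order is equal to $S_i$. (Here, $S_1$ is empty if $k=1$.) (2) Each $S_i$ occurs only twice in the cyclic sequence $CS(r)$. (3) The subsequence $S_1$ begins and ends with $m_1+1$. (4) The subsequence $S_2$ begins and ends with $m_1$.
   Context: **Continued fractions.** $[m_1,\dots,m_k]=\cfrac{1}{m_1+\cfrac{1}{m_2+\cdots+\cfrac{1}{m_k}}}$. Every rational $r$ with $0<r\le1$ is written $r=[m_1,\dots,m_k]$ with $k\ge1$, $m_i$ positive integers, and $m_k\ge2$ unless $k=1$. **The word $u_r$.** For a positive rational number $r=q/p$ with $p,q$ relatively prime positive integers, set $\epsilon_i=(-1)^{\lfloor iq/p\rfloor}$ and define a word in the free generators $a,b$ by: - if $p$ is odd, $u_{q/p}=a\,\hat u_{q/p}\,b^{(-1)^q}\,\hat u_{q/p}^{-1}$ with $\hat u_{q/p}=b^{\epsilon_1}a^{\epsilon_2}\cdots b^{\epsilon_{p-2}}a^{\epsilon_{p-1}}$ (empty if $p=1$); - if $p$ is even, $u_{q/p}=a\,\hat u_{q/p}\,a^{-1}\,\hat u_{q/p}^{-1}$ with $\hat u_{q/p}=b^{\epsilon_1}a^{\epsilon_2}\cdots a^{\epsilon_{p-2}}b^{\epsilon_{p-1}}$. **Cyclic $S$-sequence.** For a cyclically reduced word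 $v$ in $\{a,b\}$, let $(v)$ be the cyclic word consisting of all its cyclic permutations. Decompose $(v)\equiv(v_1v_2\cdots v_t)$ into maximal blocks such that all letters in each $v_i$ have exponents of one sign and all letters in $v_{i+1}$ have exponents of the opposite sign (indices mod $t$). Then $CS(v):=(\!(|v_1|,|v_2|,\dots,|v_t|)\!)$, where $|\cdot|$ is word length and double parentheses mean the sequence is considered modulo cyclic permutations. For rational $0<r\le1$, put $CS(r):=CS(u_r)$. **Conventions.** $(\!(S_1,S_2,S_1,S_2)\!)$ denotes the cyclic sequence represented by the concatenation of the finite sequences $S_1,S_2,S_1,S_2$. An occurrence of a nonempty finite sequence in a cyclic sequence is a position (modulo the length of the cyclic sequence) from which the consecutive terms, read cyclically, agree with the given sequence; "occurs only twice" means there are exactly two such positions. When $k=1$, $S_1$ is the empty sequence and conditions (2) and (3) for $S_1$ are vacuous. *)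

theory Defs
  imports Complex_Main
begin

fun cfrac :: "nat list \<Rightarrow> rat" where
  "cfrac [] = 0"
| "cfrac (m # ms) = 1 / (of_nat m + cfrac ms)"

definition admissible :: "nat list \<Rightarrow> bool" where
  "admissible ms \<longleftrightarrow> ms \<noteq> [] \<and> (\<forall>m \<in> set ms. 0 < m) \<and> (length ms = 1 \<or> 2 \<le> last ms)"

datatype gen = A | B

text \<open>A letter \<open>(g, e)\<close> with \<open>e = 1\<close> or \<open>e = - 1\<close> stands for the power \<open>g\<^sup>e\<close> of the free generator \<open>g\<close>.\<close>

type_synonym letter = "gen \<times> int"
type_synonym word = "letter list"

definition word_inv :: "word \<Rightarrow> word" where
  "word_inv w = rev (map (\<lambda>(g, e). (g, - e)) w)"

text \<open>Integer division on \<open>nat\<close> is the floor of the quotient.\<close>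

definition eps :: "nat \<Rightarrow> nat \<Rightarrow> nat \<Rightarrow> int" where
  "eps q p i = (- 1) ^ ((i * q) div p)"

text \<open>For both parities of \<open>p\<close> the letters alternate, starting with \<open>b\<close>, and there are
  \<open>p - 1\<close> of them; hence the last one is a power of \<open>a\<close> for odd \<open>p\<close> and of \<open>b\<close> for even \<open>p\<close>.\<close>

definition u_hat :: "nat \<Rightarrow> nat \<Rightarrow> word" where
  "u_hat q p = map (\<lambda>i. (if odd i then B else A, eps q p i)) [1..<p]"

definition u_word :: "nat \<Rightarrow> nat \<Rightarrow> word" where
  "u_word q p =
    (if odd p then [(A, 1)] @ u_hat q p @ [(B, (- 1) ^ q)] @ word_inv (u_hat q p)
     else [(A, 1)] @ u_hat q p @ [(A, - 1)] @ word_inv (u_hat q p))"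

text \<open>\<open>quotient_of\<close> yields the numerator and denominator in lowest terms, with positive denominator.\<close>

definition u_rat :: "rat \<Rightarrow> word" where
  "u_rat r = (case quotient_of r of (q, p) \<Rightarrow> u_word (nat q) (nat p))"

text \<open>A cyclic sequence (or cyclic word) is the set of all the finite sequences representing it.\<close>

definition cyc :: "'a list \<Rightarrow> 'a list set" where
  "cyc xs = {rotate n xs | n. True}"

text \<open>A decomposition of a cyclic word into maximal blocks of letters with exponents of one sign.
  The alternation of signs, including the one from the last block to the first, expresses maximality.\<close>

definition sign_blocks :: "word list \<Rightarrow> bool" where
  "sign_blocks vs \<longleftrightarrow>
    (\<forall>v \<in> set vs. v \<noteq> [] \<and> (\<forall>x \<in> set v. \<forall>y \<in> set v. sgn (snd x) = sgn (snd y))) \<and>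
    (\<forall>i < length vs. \<forall>x \<in> set (vs ! i). \<forall>y \<in> set (vs ! ((i + 1) mod length vs)).
       sgn (snd x) = - sgn (snd y))"

text \<open>Starting the decomposition at another block rotates the sequence of lengths, so that for a
  cyclically reduced word in which both signs occur this set is a single cyclic sequence in
  the sense of \<open>cyc\<close>.\<close>

definition CS :: "word \<Rightarrow> nat list set" where
  "CS v = {map length vs | vs. concat vs \<in> cyc v \<and> sign_blocks vs}"

definition CS_rat :: "rat \<Rightarrow> nat list set" where
  "CS_rat r = CS (u_rat r)"

text \<open>The positions in the cyclic sequence represented by \<open>T\<close> from which \<open>S\<close> can be read.
  Their number is the same for all representatives.\<close>

definition occurrences :: "'a list \<Rightarrow> 'a list \<Rightarrow> nat set" where
  "occurrences S T = {i. i < length T \<and> (\<forall>j < length S. T ! ((i + j) mod length T) = S ! j)}"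

definition occurs_only_twice :: "'a list \<Rightarrow> 'a list set \<Rightarrow> bool" where
  "occurs_only_twice S C \<longleftrightarrow> (\<forall>T \<in> C. card (occurrences S T) = 2)"

definition begins_and_ends_with :: "'a list \<Rightarrow> 'a \<Rightarrow> bool" where
  "begins_and_ends_with S x \<longleftrightarrow> S \<noteq> [] \<and> hd S = x \<and> last S = x"

text \<open>The words \<open>u_word q p\<close> are cyclically reduced as they stand, because cyclically adjacent
  letters belong to different generators.\<close>

lemma length_u_hat [simp]: "length (u_hat q p) = p - 1"
  by (simp add: u_hat_def)

lemma nth_u_hat: "i < p - 1 \<Longrightarrow> u_hat q p ! i = (if even i then B else A, eps q p (Suc i))"
  by (simp add: u_hat_def)

lemma length_u_word: "0 < p \<Longrightarrow> length (u_word q p) = 2 * p"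
  by (simp add: u_word_def word_inv_def)

lemma fst_u_word:
  assumes "0 < p" "i < 2 * p"
  shows "fst (u_word q p ! i) = (if even i then A else B)"
proof -
  consider "i = 0" | "0 < i" "i < p" | "i = p" | j where "i = p + 1 + j" "j < p - 1"
  proof (cases "i \<le> p")
    case False
    then have "i = p + 1 + (i - p - 1)" "i - p - 1 < p - 1"
      using assms by auto
    then show ?thesis using that(4) by blast
  qed (use that in force)
  then show ?thesis
  proof cases
    case 1
    then show ?thesis by (simp add: u_word_def)
  next
    case 2
    then show ?thesis
      by (auto simp: u_word_def nth_append nth_Cons' u_hat_def)
  next
    case 3
    then show ?thesis using assms
      by (auto simp: u_word_def nth_append nth_Cons')
  next
    case 4
    then have "u_word q p ! i = word_inv (u_hat q p) ! j"
      by (auto simp: u_word_def nth_append nth_Cons')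
    also have "\<dots> = (\<lambda>(g, e). (g, - e)) (u_hat q p ! (p - 1 - Suc j))"
      using 4 by (simp add: word_inv_def rev_nth)
    finally have *: "u_word q p ! i = (\<lambda>(g, e). (g, - e)) (u_hat q p ! (p - 1 - Suc j))" .
    define d where "d = p - j - 2"
    have d: "p = j + 2 + d"
      using 4 by (simp add: d_def)
    have "u_hat q p ! (p - 1 - Suc j) = (if even d then B else A, eps q p (Suc d))"
      using d nth_u_hat[of d p q] by simp
    with * d 4 show ?thesis by simp
  qed
qed

lemma u_word_cyclically_reduced:
  assumes "0 < p" "i < 2 * p"
  shows "fst (u_word q p ! ((i + 1) mod (2 * p))) \<noteq> fst (u_word q p ! i)"
proof -
  have "even ((i + 1) mod (2 * p)) \<longleftrightarrow> odd i"
    by (simp add: dvd_mod_iff)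
  then show ?thesis
    using assms fst_u_word[of p i q] fst_u_word[of p "(i + 1) mod (2 * p)" q] by simp
qed

end

theory Submission
  imports Defs "HOL-Number_Theory.Cong"
begin

text \<open>
  Write \<open>r = q / p\<close> in lowest terms. The definition of \<open>u_word q p\<close> by cases hides a uniform rule:
  the letter at every position \<open>i < 2 p\<close> has exponent \<open>(-1)\<close> to the power \<open>\<lfloor>i q / p\<rfloor>\<close>, and
  \<open>i \<mapsto> \<lfloor>i q / p\<rfloor>\<close> increases by \<open>2 q\<close> over one turn (\<open>snd_u_word\<close>). Hence the maximal sign blocks are the sets of
  positions on which \<open>\<lfloor>i q / p\<rfloor>\<close> has a given value \<open>n < 2 q\<close>, none of them is empty because
  \<open>q \<le> p\<close>, and the cyclic \<open>S\<close>-sequence consists of the gaps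
  \<open>c n = \<lceil>(n + 1) p / q\<rceil> - \<lceil>n p / q\<rceil>\<close> for \<open>n < 2 q\<close>, which have period \<open>q\<close>
  (\<open>CS_u_word\<close>; that no other decomposition has to be considered is \<open>CS_eq_cyc\<close>).

  Everything else is read off from the residues \<open>x n = (- n p) mod q\<close>, that is,
  \<open>q \<lceil>n p / q\<rceil> = n p + x n\<close>, so that \<open>q c n = p + x (n + 1) - x n\<close>. As \<open>p\<close> is invertible modulo
  \<open>q\<close>, there is exactly one \<open>l < q\<close> at which \<open>x\<close> attains its maximum \<open>q - 1\<close>; the minimum \<open>0\<close> is
  attained at \<open>0\<close> and at \<open>q\<close>. Cut the period there: \<open>S1\<close> consists of \<open>c n\<close> for \<open>0 \<le> n < l\<close> and
  \<open>S2\<close> of \<open>c n\<close> for \<open>l \<le> n < q\<close>. Each of the two pieces runs between an extreme value of \<open>x\<close> and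
  the opposite one, and this has two consequences.

  \<^item> Symmetry: on a piece \<open>x i + x j\<close> is congruent to \<open>q - 1\<close> modulo \<open>q\<close> whenever \<open>i\<close> and \<open>j\<close> are
    mirror images. A sum of two residues lies between \<open>0\<close> and \<open>2 q - 2\<close>, hence it equals
    \<open>q - 1\<close>, and reflecting the piece preserves the differences of \<open>x\<close>
    (\<open>rounding_reflect\<close>, \<open>gaps_symmetric\<close>).
  \<^item> Rigidity: a copy of a piece read from position \<open>i\<close> makes the same steps of \<open>x\<close>. Their
    total is \<open>q - 1\<close> or \<open>1 - q\<close>, and from any other starting value it would lead out of the range of
    residues; so \<open>x i\<close>, and with it \<open>i\<close> modulo \<open>q\<close>, is determined
    (\<open>gaps_agree_imp_rounding_eq\<close>). In a sequence of length \<open>2 q\<close> this leaves two positions.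

  Finally, \<open>c l\<close> is \<open>\<lfloor>p / q\<rfloor>\<close> and, for \<open>q \<noteq> 1\<close>, \<open>c 0\<close> is \<open>\<lfloor>p / q\<rfloor> + 1\<close>; the integral part of
  \<open>1 / r\<close> is the first entry of the continued fraction, and \<open>q = 1\<close> happens exactly for
  continued fractions of length one. The case \<open>q = 1\<close> fits into the same argument, with \<open>l = 0\<close>.
\<close>

section \<open>Runs of a sequence\<close>

text \<open>The linear counterpart of a decomposition into sign blocks, for an arbitrary classifying
  function \<open>f\<close>: in contrast to \<open>sign_blocks\<close>, the last block is not compared with the first, which
  makes decompositions accessible to induction on lists.\<close>

definition runs :: "('a \<Rightarrow> 'b) \<Rightarrow> 'a list list \<Rightarrow> bool" where
  "runs f vs \<longleftrightarrow>
    (\<forall>v \<in> set vs. v \<noteq> [] \<and> (\<forall>x \<in> set v. \<forall>y \<in> set v. f x = f y)) \<and>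
    successively (\<lambda>v w. \<forall>x \<in> set v. \<forall>y \<in> set w. f x \<noteq> f y) vs"

lemma runs_Cons:
  "runs f (v # vs) \<longleftrightarrow>
    v \<noteq> [] \<and> (\<forall>x \<in> set v. \<forall>y \<in> set v. f x = f y) \<and>
    (vs \<noteq> [] \<longrightarrow> (\<forall>x \<in> set v. \<forall>y \<in> set (hd vs). f x \<noteq> f y)) \<and> runs f vs"
  by (auto simp: runs_def successively_Cons)

text \<open>If one of two decompositions had the longer first block, the letter following the shorter
  one would have to agree with it (inside the longer block) and to differ from it (in the next block).\<close>

lemma runs_first_not_longer:
  assumes "runs f (v # vs)" "runs f ((v @ us) # ws)" "concat vs = us @ concat ws"
  shows "us = []"
proof (rule ccontr)
  assume "us \<noteq> []"
  then obtain u us' where us: "us = u # us'"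
    by (cases us) auto
  then obtain v' vs' where vs: "vs = v' # vs'"
    using assms(3) by (cases vs) auto
  have ne: "v \<noteq> []" "v' \<noteq> []"
    using assms(1) unfolding vs runs_Cons by blast+
  then have mem: "hd v \<in> set v" "u \<in> set v'"
    using assms(3) unfolding us vs by (cases v'; simp)+
  have "\<forall>x \<in> set v. \<forall>y \<in> set v'. f x \<noteq> f y"
    using assms(1) unfolding vs runs_Cons by (metis list.distinct(1) list.sel(1))
  moreover have "\<forall>x \<in> set (v @ us). \<forall>y \<in> set (v @ us). f x = f y"
    using assms(2) unfolding runs_Cons by blast
  then have "f (hd v) = f u"
    using mem us by simp
  ultimately show False
    using mem by blast
qed

lemma runs_unique:
  assumes "runs f vs" "runs f ws" "concat vs = concat ws"
  shows "vs = ws"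
  using assms
proof (induction vs arbitrary: ws)
  case Nil
  then show ?case
    by (cases ws) (auto simp: runs_Cons)
next
  case (Cons v vs)
  then obtain w ws' where ws: "ws = w # ws'"
    by (cases ws) (auto simp: runs_Cons)
  have eq: "v @ concat vs = w @ concat ws'"
    using Cons.prems(3) ws by simp
  then obtain us where "v = w @ us \<and> us @ concat vs = concat ws' \<or>
      v @ us = w \<and> concat vs = us @ concat ws'"
    unfolding append_eq_append_conv2 by blast
  then have "v = w"
  proof (elim disjE conjE)
    assume us: "v = w @ us" "us @ concat vs = concat ws'"
    have "us = []"
      by (rule runs_first_not_longer[of f w ws' us vs])
        (use Cons.prems(1,2) in \<open>simp_all only: ws us\<close>)
    then show ?thesis
      using us(1) by simp
  next
    assume us: "v @ us = w" "concat vs = us @ concat ws'"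
    have "us = []"
      by (rule runs_first_not_longer[of f v vs us ws'])
        (use Cons.prems(1,2) in \<open>simp_all only: ws us\<close>)
    then show ?thesis
      using us(1) by simp
  qed
  have "runs f vs" "runs f ws'"
    using Cons.prems(1,2) unfolding ws runs_Cons by blast+
  moreover note \<open>v = w\<close>
  moreover from this eq have "concat vs = concat ws'"
    by simp
  ultimately show ?case
    using Cons.IH[of ws'] by (simp only: ws)
qed

text \<open>A place where \<open>f\<close> changes cannot lie inside a block on which \<open>f\<close> is constant.\<close>

lemma runs_split_at_change:
  assumes const: "\<forall>v \<in> set vs. \<forall>x \<in> set v. \<forall>y \<in> set v. f x = f y"
    and eq: "concat vs = xs @ ys"
    and change: "xs \<noteq> [] \<Longrightarrow> ys \<noteq> [] \<Longrightarrow> f (last xs) \<noteq> f (hd ys)"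
  obtains as bs where "vs = as @ bs" "concat as = xs" "concat bs = ys"
proof (cases "vs = []")
  case True
  with eq show ?thesis
    by (intro that[of "[]" "[]"]) simp_all
next
  case False
  then obtain as v v' bs where *: "vs = as @ (v @ v') # bs" "xs = concat as @ v" "ys = v' @ concat bs"
    using eq by (auto simp: concat_eq_append_conv)
  consider "v = []" | "v' = []" | "v \<noteq> []" "v' \<noteq> []"
    by blast
  then show ?thesis
  proof cases
    case 1
    show ?thesis
      by (rule that[of as "v' # bs"]) (simp_all add: * 1)
  next
    case 2
    show ?thesis
      by (rule that[of "as @ [v]" bs]) (simp_all add: * 2)
  next
    case 3
    then have "last v \<in> set (v @ v')" "hd v' \<in> set (v @ v')"
      by auto
    moreover have "v @ v' \<in> set vs"
      using * by simp
    ultimately have "f (last v) = f (hd v')"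
      using const by blast
    then show ?thesis
      using change * 3 by simp
  qed
qed

lemma concat_rotate: "\<exists>m. concat (rotate n xss) = rotate m (concat xss)"
proof -
  have "concat (rotate n xss) =
      rotate (length (concat (take (n mod length xss) xss))) (concat xss)"
    unfolding rotate_drop_take[of n]
    by (metis append_take_drop_id concat_append rotate_append)
  then show ?thesis ..
qed

lemma sign_blocks_rotate:
  assumes "sign_blocks vs"
  shows "sign_blocks (rotate n vs)"
proof -
  have "sgn (snd x) = - sgn (snd y)"
    if "i < length vs" "x \<in> set (rotate n vs ! i)"
      "y \<in> set (rotate n vs ! ((i + 1) mod length vs))" for i x y
  proof -
    let ?l = "length vs"
    have "0 < ?l"
      using that(1) by linarith
    moreover have "(n + (i + 1) mod ?l) mod ?l = ((n + i) mod ?l + 1) mod ?l"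
      by (simp add: mod_simps)
    ultimately have "x \<in> set (vs ! ((n + i) mod ?l))" "y \<in> set (vs ! (((n + i) mod ?l + 1) mod ?l))"
      using that by (auto simp: nth_rotate)
    then show ?thesis
      using assms \<open>0 < ?l\<close> unfolding sign_blocks_def by (meson mod_less_divisor)
  qed
  moreover have "\<forall>v \<in> set (rotate n vs). v \<noteq> [] \<and> (\<forall>x \<in> set v. \<forall>y \<in> set v. sgn (snd x) = sgn (snd y))"
    using assms unfolding sign_blocks_def set_rotate by blast
  ultimately show ?thesis
    unfolding sign_blocks_def length_rotate by blast
qed

lemma sign_blocks_imp_runs:
  assumes "sign_blocks vs" "\<And>x. x \<in> set (concat vs) \<Longrightarrow> snd x \<noteq> 0"
  shows "runs (\<lambda>x. sgn (snd x)) vs"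
proof -
  have "sgn (snd x) \<noteq> sgn (snd y)"
    if "Suc i < length vs" "x \<in> set (vs ! i)" "y \<in> set (vs ! Suc i)" for i x y
  proof -
    have "sgn (snd x) = - sgn (snd y)"
      using assms(1)[unfolded sign_blocks_def, THEN conjunct2, rule_format, of i x y] that by simp
    moreover have "snd y \<noteq> 0"
      using assms(2) that by (metis UN_I nth_mem set_concat)
    ultimately show ?thesis
      by (auto simp: sgn_if split: if_splits)
  qed
  moreover have "\<forall>v \<in> set vs. v \<noteq> [] \<and> (\<forall>x \<in> set v. \<forall>y \<in> set v. sgn (snd x) = sgn (snd y))"
    using assms(1) unfolding sign_blocks_def by blast
  ultimately show ?thesis
    unfolding runs_def successively_conv_nth by blast
qed

text \<open>The cyclic \<open>S\<close>-sequence of a word is a single cyclic sequence, given by any one block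
  decomposition. The blocks \<open>vs\<close> of a rotation of the word can be regrouped: the point at which the
  original word starts separates different signs, hence it is a block boundary of \<open>vs\<close>, and moving the
  blocks before it to the end yields a decomposition of the original word, which is unique.\<close>

lemma CS_eq_cyc:
  assumes blocks: "sign_blocks ws" and nz: "\<And>x. x \<in> set (concat ws) \<Longrightarrow> snd x \<noteq> 0"
  shows "CS (concat ws) = cyc (map length ws)"
proof (intro subset_antisym subsetI)
  fix T assume "T \<in> cyc (map length ws)"
  then obtain n where n: "T = map length (rotate n ws)"
    by (auto simp: cyc_def rotate_map)
  then show "T \<in> CS (concat ws)"
    using concat_rotate[of n ws] sign_blocks_rotate[OF blocks, of n]
    by (auto simp: CS_def cyc_def)
next
  fix T assume "T \<in> CS (concat ws)"
  then obtain vs n where T: "T = map length vs" and vs: "sign_blocks vs"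
    and eq: "concat vs = rotate n (concat ws)"
    by (auto simp: CS_def cyc_def)
  \<comment> \<open>Reduced to less than the length, so that rotating means exchanging two parts of the word.\<close>
  define k where "k = n mod length (concat ws)"
  have split: "concat vs = drop k (concat ws) @ take k (concat ws)"
    using eq by (simp only: k_def rotate_drop_take)
  have const: "\<forall>v \<in> set vs. \<forall>x \<in> set v. \<forall>y \<in> set v. sgn (snd x) = sgn (snd y)"
    using vs unfolding sign_blocks_def by blast
  have "sgn (snd (last (drop k (concat ws)))) \<noteq> sgn (snd (hd (take k (concat ws))))"
    if "drop k (concat ws) \<noteq> []" "take k (concat ws) \<noteq> []"
  proof -
    have ne: "concat ws \<noteq> []" "ws \<noteq> []"
      using that(1) by (metis drop_Nil, metis concat.simps(1) drop_Nil)
    then have "hd ws \<in> set ws" "last ws \<in> set ws"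
      by simp_all
    then have "hd ws \<noteq> []" "last ws \<noteq> []"
      using blocks unfolding sign_blocks_def by blast+
    then have mem: "hd (concat ws) \<in> set (ws ! 0)" "last (concat ws) \<in> set (ws ! (length ws - 1))"
      using ne by (metis hd_concat hd_conv_nth hd_in_set,
          metis append_butlast_last_id append_Nil2 concat.simps concat_append last_appendR
            last_conv_nth last_in_set)
    \<comment> \<open>The cyclic clause of the block decomposition compares its last block with its first.\<close>
    have "sgn (snd (last (concat ws))) = - sgn (snd (hd (concat ws)))"
      using blocks[unfolded sign_blocks_def, THEN conjunct2, rule_format, of "length ws - 1"] ne mem
      by simp
    moreover have "snd (hd (concat ws)) \<noteq> 0"
      using nz ne(1) by (meson hd_in_set)
    ultimately show ?thesis
      using that by (auto simp: last_drop hd_take sgn_if split: if_splits)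
  qed
  then obtain as bs where ab: "vs = as @ bs" "concat as = drop k (concat ws)"
      "concat bs = take k (concat ws)"
    by (rule runs_split_at_change[OF const split])
  have rot: "bs @ as = rotate (length as) vs"
    using ab by (simp add: rotate_append)
  have "concat (bs @ as) = concat ws"
    unfolding concat_append ab by simp
  moreover have "sign_blocks (bs @ as)"
    unfolding rot by (rule sign_blocks_rotate[OF vs])
  ultimately have "bs @ as = ws"
    using runs_unique sign_blocks_imp_runs blocks nz by metis
  then have "T = rotate (length bs) (map length ws)"
    unfolding T ab(1) by (metis map_append rotate_append length_map)
  then show "T \<in> cyc (map length ws)"
    by (auto simp: cyc_def)
qed

section \<open>The signs of the word of a rational number\<close>

text \<open>Since \<open>i q / p\<close> and \<open>e q / p\<close> are not integers and add up to \<open>2 q\<close>, their fractional parts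
  add up to one. This accounts for the inverted second half of the words \<open>u_word q p\<close>.\<close>

lemma div_add_div_reflect:
  fixes e i p q :: nat
  assumes "coprime p q" "0 < e" "e < p" "i + e = 2 * p"
  shows "i * q div p + e * q div p + 1 = 2 * q"
proof -
  define a where "a = e * q div p"
  define s where "s = e * q mod p"
  have eq: "e * q = a * p + s"
    by (simp add: a_def s_def)
  have "\<not> p dvd e * q"
    using assms by (simp add: coprime_dvd_mult_left_iff nat_dvd_not_less)
  then have s: "0 < s" "s < p"
    using assms by (auto simp: s_def mod_eq_0_iff_dvd intro: gr0I)
  have "i * q + e * q = 2 * q * p"
    using assms(4) by (metis add_mult_distrib mult.assoc mult.commute)
  then have "int i * int q + int e * int q = 2 * int q * int p"
    by (metis of_nat_add of_nat_mult of_nat_numeral)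
  moreover have "int e * int q = int a * int p + int s"
    using eq by (metis of_nat_add of_nat_mult)
  ultimately have iq: "int i * int q = (2 * int q - int a - 1) * int p + (int p - int s)"
    by (simp add: algebra_simps)
  have "int i * q div int p = 2 * int q - int a - 1"
    unfolding iq using s by simp
  then have "int (i * q div p) = 2 * int q - int a - 1"
    by (simp add: zdiv_int)
  then show ?thesis
    unfolding a_def[symmetric] by linarith
qed

lemma odd_sum_parity:
  fixes a b c :: nat
  assumes "a + b + 1 = 2 * c"
  shows "even a \<longleftrightarrow> odd b"
  using assms by presburger

text \<open>At position \<open>p\<close> both parities of \<open>p\<close> give the exponent \<open>(-1)\<close> to the power \<open>q\<close>, because
  \<open>q\<close> is odd when \<open>p\<close> is even. Beyond that position, inverting \<open>u_hat q p\<close> reverses it and changes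
  its signs, which is the reflection \<open>i \<mapsto> 2 p - i\<close>.\<close>

lemma snd_u_word:
  assumes "coprime p q" "0 < p" "i < 2 * p"
  shows "snd (u_word q p ! i) = (- 1) ^ (i * q div p)"
proof -
  consider "i = 0" | "0 < i" "i < p" | "i = p" | j where "i = p + 1 + j" "j < p - 1"
  proof (cases "i \<le> p")
    case False
    then have "i = p + 1 + (i - p - 1)" "i - p - 1 < p - 1"
      using assms by auto
    then show ?thesis using that(4) by blast
  qed (use that in force)
  then show ?thesis
  proof cases
    case 1
    then show ?thesis by (simp add: u_word_def)
  next
    case 2
    then obtain j where j: "i = Suc j" "j < p - 1"
      by (cases i) auto
    then show ?thesis
      by (simp add: u_word_def nth_append nth_u_hat eps_def)
  next
    case 3
    have "odd q" if "even p"
      using that assms(1) by (metis coprime_common_divisor odd_one)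
    with 3 show ?thesis using assms
      by (auto simp: u_word_def nth_append nth_Cons')
  next
    case 4
    define d where "d = p - j - 2"
    have d: "p = j + 2 + d"
      using 4 by (simp add: d_def)
    have "u_word q p ! i = word_inv (u_hat q p) ! j"
      using 4 by (auto simp: u_word_def nth_append nth_Cons')
    also have "\<dots> = (\<lambda>(g, e). (g, - e)) (u_hat q p ! d)"
      using 4 d by (simp add: word_inv_def rev_nth)
    finally have "snd (u_word q p ! i) = - ((- 1) ^ (Suc d * q div p))"
      using d by (simp add: nth_u_hat eps_def split_beta del: mult_Suc)
    moreover have "i * q div p + Suc d * q div p + 1 = 2 * q"
      using div_add_div_reflect[of p q "Suc d" i] assms(1) 4 d by simp
    then have "even (i * q div p) \<longleftrightarrow> odd (Suc d * q div p)"
      by (rule odd_sum_parity)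
    ultimately show ?thesis
      by (simp add: minus_one_power_iff del: mult_Suc)
  qed
qed

section \<open>Gaps between rounded multiples of a fraction\<close>

locale coprime_fraction =
  fixes p q :: nat
  assumes coprime: "coprime p q" and q_pos: "0 < q" and q_le: "q \<le> p"
begin

text \<open>The amount, in units of \<open>1 / q\<close>, by which \<open>n p / q\<close> is rounded up to reach an integer.\<close>

definition rounding :: "nat \<Rightarrow> int" where
  "rounding n = (- (int n * int p)) mod int q"

text \<open>The least integer not below \<open>n p / q\<close>, which is where the block with number \<open>n\<close> begins.
  The quotient is negated twice because integer division rounds down.\<close>

definition bound :: "nat \<Rightarrow> nat" where
  "bound n = nat (- ((- (int n * int p)) div int q))"

definition gap :: "nat \<Rightarrow> nat" where
  "gap n = bound (Suc n) - bound n"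

lemma rounding_bounds: "0 \<le> rounding n" "rounding n \<le> int q - 1"
  using q_pos by (simp_all add: rounding_def)

lemma bound_eq: "int q * int (bound n) = int n * int p + rounding n"
proof -
  have "(- (int n * int p)) div int q \<le> 0"
    using q_pos by (simp add: div_nonpos_pos_le0)
  then have "int (bound n) = - ((- (int n * int p)) div int q)"
    by (simp add: bound_def)
  then show ?thesis
    using mult_div_mod_eq[of "int q" "- (int n * int p)"]
    unfolding rounding_def by (metis (no_types, opaque_lifting) add.commute add_diff_cancel_left'
        diff_minus_eq_add minus_mult_right uminus_add_conv_diff)
qed

lemma bound_0 [simp]: "bound 0 = 0"
  by (simp add: bound_def)

lemma bound_double_q: "bound (2 * q) = 2 * p"
proof -
  have "- (int (2 * q) * int p) = int q * (- (2 * int p))"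
    by simp
  then show ?thesis
    using q_pos unfolding bound_def by (simp only: nonzero_mult_div_cancel_left of_nat_eq_0_iff)
qed

lemma bound_less: "bound n < bound (Suc n)"
proof -
  have "int q * int (bound n) < int q * int (bound (Suc n))"
    using q_le rounding_bounds[of n] rounding_bounds[of "Suc n"] unfolding bound_eq
    by (simp add: algebra_simps)
  then show ?thesis
    using q_pos by simp
qed

lemma bound_mono:
  assumes "m \<le> n"
  shows "bound m \<le> bound n"
  by (rule lift_Suc_mono_le[of bound]) (simp_all add: assms bound_less less_imp_le)

lemma gap_eq: "int q * int (gap n) = int p + rounding (Suc n) - rounding n"
proof -
  have "int (gap n) = int (bound (Suc n)) - int (bound n)"
    using bound_less[of n] by (simp add: gap_def of_nat_diff)
  then have "int q * int (gap n) = int q * int (bound (Suc n)) - int q * int (bound n)"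
    by (simp only: right_diff_distrib)
  then show ?thesis
    unfolding bound_eq by (simp add: algebra_simps)
qed

text \<open>A gap depends only on the step that the rounding makes; this is how properties of
  roundings become properties of gaps.\<close>

lemma gap_cong:
  assumes "rounding (Suc i) - rounding i = rounding (Suc j) - rounding j"
  shows "gap i = gap j"
proof -
  have "int q * int (gap i) = int q * int (gap j)"
    using assms by (simp add: gap_eq)
  then show ?thesis
    using q_pos by simp
qed

text \<open>As \<open>p\<close> is invertible modulo \<open>q\<close>, an index is determined modulo \<open>q\<close> by its rounding.\<close>

lemma rounding_inject: "rounding i = rounding j \<longleftrightarrow> i mod q = j mod q"
proof -
  have "rounding i = rounding j \<longleftrightarrow> int q dvd (int j - int i) * int p"
    by (simp add: rounding_def mod_eq_dvd_iff algebra_simps)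
  also have "\<dots> \<longleftrightarrow> int q dvd int j - int i"
    using coprime by (simp add: coprime_dvd_mult_left_iff coprime_commute)
  also have "\<dots> \<longleftrightarrow> int j mod int q = int i mod int q"
    by (simp add: mod_eq_dvd_iff)
  finally show ?thesis
    by (auto simp flip: of_nat_mod)
qed

lemma gap_mod: "gap (n mod q) = gap n"
proof -
  have "rounding (n mod q) = rounding n" "rounding (Suc (n mod q)) = rounding (Suc n)"
    by (simp_all add: rounding_inject mod_Suc_eq)
  then show ?thesis
    by (intro gap_cong) simp
qed

lemma rounding_0 [simp]: "rounding 0 = 0"
  by (simp add: rounding_def)

lemma rounding_q [simp]: "rounding q = 0"
  by (simp add: rounding_def)

lemma rounding_add:
  assumes "i + j = a + b"
  shows "(rounding i + rounding j) mod int q = (rounding a + rounding b) mod int q"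
proof -
  have "(rounding k + rounding l) mod int q = (- (int (k + l) * int p)) mod int q" for k l
    by (simp add: rounding_def mod_simps algebra_simps)
  then show ?thesis
    using assms by metis
qed

text \<open>Both sums are congruent modulo \<open>q\<close>, and \<open>q - 1\<close> is the only number between \<open>0\<close> and
  \<open>2 q - 2\<close> in its residue class, so the congruence is an equality.\<close>

lemma rounding_reflect:
  assumes "rounding a + rounding b = int q - 1" "i + j = a + b"
  shows "rounding i + rounding j = int q - 1"
proof -
  let ?s = "rounding i + rounding j"
  have "?s mod int q = (int q - 1) mod int q"
    using rounding_add[OF assms(2)] assms(1) by simp
  then have "int q dvd ?s - (int q - 1)"
    by (simp only: mod_eq_dvd_iff)
  moreover have "\<bar>?s - (int q - 1)\<bar> < int q"
    using rounding_bounds[of i] rounding_bounds[of j] by linarith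
  ultimately have "?s - (int q - 1) = 0"
    using dvd_imp_le_int[of "?s - (int q - 1)" "int q"] by linarith
  then show ?thesis
    by simp
qed

text \<open>Reflection of the index range negates roundings up to a constant and reverses their order,
  so it preserves their steps.\<close>

lemma gaps_symmetric:
  assumes "rounding a + rounding b = int q - 1"
  shows "rev (map gap [a..<b]) = map gap [a..<b]"
proof (intro nth_equalityI)
  fix n assume "n < length (rev (map gap [a..<b]))"
  then have n: "n < b - a"
    by simp
  define i where "i = b - Suc n"
  have i: "i + Suc (a + n) = a + b" "Suc i + (a + n) = a + b"
    using n by (auto simp: i_def)
  have "gap i = gap (a + n)"
    using rounding_reflect[OF assms i(1)] rounding_reflect[OF assms i(2)]
    by (intro gap_cong) linarith
  moreover have "rev (map gap [a..<b]) ! n = gap i"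
    using n by (simp add: rev_nth i_def)
  ultimately show "rev (map gap [a..<b]) ! n = map gap [a..<b] ! n"
    using n by simp
qed simp

text \<open>Equal gaps mean equal steps, so along the agreement the roundings differ by the constant
  \<open>rounding i - rounding a\<close>. Being extreme, the rounding at \<open>a\<close> bounds this constant on one side
  by zero, and the opposite extreme at \<open>b\<close> bounds it on the other side.\<close>

lemma gaps_agree_imp_rounding_eq:
  assumes ends: "rounding a = 0 \<and> rounding b = int q - 1 \<or> rounding a = int q - 1 \<and> rounding b = 0"
    and "a \<le> b" and agree: "\<forall>j < b - a. gap (i + j) = gap (a + j)"
  shows "rounding i = rounding a"
proof -
  have shift: "rounding (i + j) - rounding (a + j) = rounding i - rounding a" if "j \<le> b - a" for j
    using that
  proof (induction j)
    case (Suc j)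
    then show ?case
      using agree gap_eq[of "i + j"] gap_eq[of "a + j"] by simp
  qed simp
  have "rounding (i + (b - a)) - rounding b = rounding i - rounding a"
    using shift[of "b - a"] \<open>a \<le> b\<close> by simp
  then show ?thesis
    using ends rounding_bounds[of i] rounding_bounds[of "i + (b - a)"] by linarith
qed

lemma nth_rotated_gaps:
  assumes "i < 2 * q"
  shows "rotate n (map gap [0..<2 * q]) ! i = gap (n + i)"
proof -
  have "(n + i) mod (2 * q) mod q = (n + i) mod q"
    by (simp add: mod_mod_cancel)
  moreover have "(n + i) mod (2 * q) < 2 * q"
    using q_pos by simp
  ultimately have "gap ((n + i) mod (2 * q)) = gap (n + i)"
    by (metis gap_mod)
  then show ?thesis
    using assms \<open>(n + i) mod (2 * q) < 2 * q\<close> by (simp add: nth_rotate)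
qed

lemma card_residue_class_two_periods:
  "card {i. i < 2 * q \<and> (n + i) mod q = a mod q} = 2"
proof -
  \<comment> \<open>The residue of \<open>a - n\<close>, written with \<open>q - 1\<close> in place of \<open>-1\<close> to avoid truncated subtraction.\<close>
  define b where "b = (a + (q - 1) * n) mod q"
  have "b < q"
    using q_pos by (simp add: b_def)
  have "n + (a + (q - 1) * n) = a + q * n"
    using q_pos by (cases q) auto
  then have "(n + (a + (q - 1) * n)) mod q = a mod q"
    by (metis mod_mult_self2)
  then have b: "(n + b) mod q = a mod q"
    unfolding b_def by (simp only: mod_add_right_eq)
  have "(n + i) mod q = a mod q \<longleftrightarrow> i mod q = b" for i
  proof -
    have "(n + i) mod q = (n + b) mod q \<longleftrightarrow> i mod q = b mod q"
      using cong_add_lcancel_nat[of n i b q] by (simp only: cong_def)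
    then show ?thesis
      using b \<open>b < q\<close> by simp
  qed
  then have "{i. i < 2 * q \<and> (n + i) mod q = a mod q} = {i. i < 2 * q \<and> i mod q = b}"
    by simp
  also have "\<dots> = {b, b + q}"
  proof (intro set_eqI iffI)
    fix i assume "i \<in> {i. i < 2 * q \<and> i mod q = b}"
    then show "i \<in> {b, b + q}"
      by (cases "i < q") (auto simp: le_mod_geq not_less)
  qed (use \<open>b < q\<close> in auto)
  finally show ?thesis
    using q_pos by simp
qed

lemma gaps_occur_only_twice:
  assumes ends: "rounding a = 0 \<and> rounding b = int q - 1 \<or> rounding a = int q - 1 \<and> rounding b = 0"
    and "a \<le> b"
  shows "occurs_only_twice (map gap [a..<b]) (cyc (map gap [0..<2 * q]))"
  unfolding occurs_only_twice_def
proof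
  fix T assume "T \<in> cyc (map gap [0..<2 * q])"
  then obtain n where T: "T = rotate n (map gap [0..<2 * q])"
    by (auto simp: cyc_def)
  have T_nth: "T ! ((i + j) mod length T) = gap (n + i + j)" for i j
  proof -
    have "T ! ((i + j) mod (2 * q)) = gap (n + (i + j) mod (2 * q))"
      unfolding T using q_pos by (intro nth_rotated_gaps) simp
    also have "\<dots> = gap (n + i + j)"
    proof -
      have "(n + (i + j) mod (2 * q)) mod q = (n + i + j) mod q"
        by (metis add.assoc dvd_triv_right mod_add_right_eq mod_mod_cancel)
      then show ?thesis
        by (metis gap_mod)
    qed
    finally show ?thesis
      by (simp add: T)
  qed
  have "(\<forall>j < b - a. gap (n + i + j) = gap (a + j)) \<longleftrightarrow> (n + i) mod q = a mod q" for i
  proof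
    assume "\<forall>j < b - a. gap (n + i + j) = gap (a + j)"
    then show "(n + i) mod q = a mod q"
      using gaps_agree_imp_rounding_eq[OF ends \<open>a \<le> b\<close>] rounding_inject by blast
  next
    assume "(n + i) mod q = a mod q"
    then have "(n + i + j) mod q = (a + j) mod q" for j
      by (metis mod_add_left_eq)
    then show "\<forall>j < b - a. gap (n + i + j) = gap (a + j)"
      by (metis gap_mod)
  qed
  then have "occurrences (map gap [a..<b]) T = {i. i < 2 * q \<and> (n + i) mod q = a mod q}"
    unfolding occurrences_def T_nth by (simp add: T)
  then show "card (occurrences (map gap [a..<b]) T) = 2"
    by (simp add: card_residue_class_two_periods)
qed

lemma obtain_rounding_max:
  obtains l where "l < q" "rounding l = int q - 1"
proof -
  \<comment> \<open>An index that is the inverse of \<open>p\<close> modulo \<open>q\<close> has the rounding \<open>(- 1) mod q\<close>.\<close>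
  obtain k where "(int p * k) mod int q = 1 mod int q"
    using coprime cong_solve_coprime_int[of "int p" "int q"] by (auto simp: cong_def)
  define l where "l = nat (k mod int q)"
  have l: "int l = k mod int q" "l < q"
    using q_pos by (auto simp: l_def nat_less_iff)
  have "rounding l = (- (int p * k)) mod int q"
    unfolding rounding_def l by (metis mod_minus_eq mod_mult_right_eq mult.commute)
  also have "\<dots> = (- 1) mod int q"
    using \<open>(int p * k) mod int q = 1 mod int q\<close> by (metis mod_minus_cong)
  also have "\<dots> = int q - 1"
    using q_pos by (simp add: zmod_minus1)
  finally show ?thesis
    using that l by blast
qed

lemma gap_rounding_max:
  assumes "rounding l = int q - 1"
  shows "gap l = p div q"
proof -
  have "int q * int (gap l) \<le> int p" "int p < int q * int (gap l) + int q"
    using gap_eq[of l] assms rounding_bounds[of "Suc l"] by linarith+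
  then have "gap l * q \<le> p" "p < Suc (gap l) * q"
    by (simp_all add: mult.commute flip: of_nat_mult of_nat_add)
  then show ?thesis
    by (simp add: div_nat_eqI mult.commute)
qed

lemma gap_0:
  assumes "q \<noteq> 1"
  shows "gap 0 = p div q + 1"
proof -
  have "rounding 1 \<noteq> rounding 0"
    using assms q_pos unfolding rounding_inject by (cases "q = 1") auto
  then have "0 < rounding 1"
    using rounding_bounds(1)[of 1] by simp
  then have "int p < int q * int (gap 0)" "int q * int (gap 0) < int p + int q"
    using gap_eq[of 0] rounding_bounds(2)[of 1] by simp_all
  then have *: "p < q * gap 0" "q * gap 0 < p + q"
    by (simp_all flip: of_nat_mult of_nat_add)
  then obtain g where g: "gap 0 = Suc g"
    by (cases "gap 0") auto
  have "p div q = g"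
    using * g by (intro div_nat_eqI) simp_all
  then show ?thesis
    using g by simp
qed

lemma div_eq_of_mem_block:
  assumes "bound n \<le> i" "i < bound (Suc n)"
  shows "i * q div p = n"
proof -
  have "int n * int p \<le> int q * int (bound n)" "int q * int (bound n) \<le> int q * int i"
    using assms(1) rounding_bounds[of n] by (simp add: bound_eq, intro mult_left_mono) simp_all
  moreover have "int q * (int i + 1) \<le> int q * int (bound (Suc n))"
    using assms(2) by (intro mult_left_mono) auto
  then have "int q * int i < int (Suc n) * int p"
    unfolding bound_eq using rounding_bounds[of "Suc n"] by (simp add: algebra_simps)
  ultimately have "int (n * p) \<le> int (i * q)" "int (i * q) < int (Suc n * p)"
    unfolding of_nat_mult by (simp_all only: mult.commute[of "int q"])
  then show ?thesis
    unfolding of_nat_le_iff of_nat_less_iff by (intro div_nat_eqI) (simp_all add: mult.commute)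
qed

lemma concat_consecutive_blocks:
  "concat (map (\<lambda>n. [bound n..<bound (Suc n)]) [0..<k]) = [0..<bound k]"
proof (induction k)
  case (Suc k)
  then show ?case
    using bound_less[of k] upt_add_eq_append[of 0 "bound k" "bound (Suc k) - bound k"] by simp
qed simp

lemma CS_u_word: "CS (u_word q p) = cyc (map gap [0..<2 * q])"
proof -
  define u where "u = u_word q p"
  define blk where "blk n = map ((!) u) [bound n..<bound (Suc n)]" for n
  define ws where "ws = map blk [0..<2 * q]"
  have p_pos: "0 < p"
    using q_pos q_le by simp
  have len: "length u = 2 * p"
    using p_pos by (simp add: u_def length_u_word)
  have "concat ws = map ((!) u) (concat (map (\<lambda>n. [bound n..<bound (Suc n)]) [0..<2 * q]))"
    by (simp add: ws_def blk_def[abs_def] map_concat comp_def)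
  also have "\<dots> = u"
    unfolding concat_consecutive_blocks bound_double_q by (metis len map_nth)
  finally have concat: "concat ws = u" .
  have snd_u: "snd (u ! i) = (- 1) ^ (i * q div p)" if "i < 2 * p" for i
    using snd_u_word coprime p_pos that by (simp add: u_def)
  have snd_blk: "snd x = (- 1) ^ n" if n: "n < 2 * q" and x: "x \<in> set (blk n)" for n x
  proof -
    obtain i where i: "bound n \<le> i" "i < bound (Suc n)" "x = u ! i"
      using x by (auto simp: blk_def)
    have "bound (Suc n) \<le> bound (2 * q)"
      using n by (intro bound_mono) simp
    then show ?thesis
      using i snd_u div_eq_of_mem_block by (simp add: bound_double_q)
  qed
  have blk_ne: "blk n \<noteq> []" for n
    using bound_less[of n] by (simp add: blk_def)
  have "sign_blocks ws"
    unfolding sign_blocks_def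
  proof (intro conjI ballI allI impI)
    fix v assume "v \<in> set ws"
    then show "v \<noteq> []"
      using blk_ne by (auto simp: ws_def)
  next
    fix v x y assume "v \<in> set ws" "x \<in> set v" "y \<in> set v"
    moreover from this obtain n where "n < 2 * q" "v = blk n"
      by (auto simp: ws_def)
    ultimately show "sgn (snd x) = sgn (snd y)"
      by (simp add: snd_blk)
  next
    fix i x y
    assume "i < length ws" "x \<in> set (ws ! i)" "y \<in> set (ws ! ((i + 1) mod length ws))"
    moreover from this have "(i + 1) mod (2 * q) < 2 * q"
      using q_pos by simp
    ultimately have "snd x = (- 1) ^ i" "snd y = (- 1) ^ ((i + 1) mod (2 * q))"
      using snd_blk by (auto simp: ws_def)
    then show "sgn (snd x) = - sgn (snd y)"
      by (simp add: minus_one_power_iff dvd_mod_iff)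
  qed
  moreover have "snd x \<noteq> 0" if "x \<in> set (concat ws)" for x
    using that snd_u len unfolding concat by (auto simp: in_set_conv_nth)
  ultimately have "CS u = cyc (map length ws)"
    using CS_eq_cyc[of ws] concat by simp
  then show ?thesis
    by (simp add: u_def ws_def blk_def comp_def gap_def[abs_def])
qed

lemma two_periods_eq:
  assumes "l \<le> q"
  shows "map gap [0..<2 * q] =
    map gap [0..<l] @ map gap [l..<q] @ map gap [0..<l] @ map gap [l..<q]"
proof -
  have "map gap [q..<2 * q] = map gap [0..<q]"
    by (rule nth_equalityI) (simp_all, metis gap_mod mod_add_self1)
  moreover have "map gap [0..<l] @ map gap [l..<q] = map gap [0..<q]"
    using assms by (metis le_add_diff_inverse map_append upt_add_eq_append zero_le)
  moreover have "map gap [0..<2 * q] = map gap [0..<q] @ map gap [q..<2 * q]"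
    by (metis map_append mult_2 upt_add_eq_append zero_le)
  ultimately show ?thesis
    by simp
qed

end

section \<open>Continued fractions\<close>

lemma cfrac_bounds:
  assumes "admissible ms"
  shows "0 < cfrac ms \<and> cfrac ms \<le> 1 \<and> (cfrac ms = 1 \<longrightarrow> ms = [1])"
  using assms
proof (induction ms)
  case Nil
  then show ?case
    by (simp add: admissible_def)
next
  case (Cons m ms)
  have m: "1 \<le> (of_nat m :: rat)"
    using Cons.prems by (simp add: admissible_def)
  show ?case
  proof (cases "ms = []")
    case True
    then show ?thesis
      using m by auto
  next
    case False
    with Cons.prems have "admissible ms"
      by (auto simp: admissible_def)
    then have "0 < cfrac ms"
      using Cons.IH by simp
    then show ?thesis
      using m by (auto simp: field_simps)
  qed
qed

text \<open>The value one is excluded for the tail because its last entry is at least two; hence the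
  first entry is the integral part of the reciprocal of the whole fraction.\<close>

lemma cfrac_tail_bounds:
  assumes "admissible (m # ms)"
  shows "0 \<le> cfrac ms" "cfrac ms < 1" "cfrac ms = 0 \<longleftrightarrow> ms = []"
proof -
  have "0 < cfrac ms \<and> cfrac ms < 1" if "ms \<noteq> []"
  proof -
    have "admissible ms" "ms \<noteq> [1]"
      using assms that by (auto simp: admissible_def)
    then show ?thesis
      using cfrac_bounds[of ms] by (auto simp: less_le)
  qed
  then show "0 \<le> cfrac ms" "cfrac ms < 1" "cfrac ms = 0 \<longleftrightarrow> ms = []"
    by (cases "ms = []"; force)+
qed

lemma cfrac_quotient:
  fixes p q :: nat
  assumes adm: "admissible (m # ms)" and "coprime p q" "0 < q" "0 < p"
    and eq: "cfrac (m # ms) = of_nat q / of_nat p"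
  shows "p div q = m" "q = 1 \<longleftrightarrow> ms = []"
proof -
  note tail = cfrac_tail_bounds[OF adm]
  have "0 < (of_nat m :: rat)"
    using adm by (simp add: admissible_def)
  then have p: "of_nat p = of_nat q * (of_nat m + cfrac ms)"
    using eq tail assms by (simp add: field_simps)
  have "(of_nat (q * m) :: rat) \<le> of_nat p" "(of_nat p :: rat) < of_nat (q * Suc m)"
    unfolding p using tail \<open>0 < q\<close> by (simp_all add: algebra_simps)
  then have "q * m \<le> p" "p < q * Suc m"
    by (simp_all only: of_nat_le_iff of_nat_less_iff)
  then show m: "p div q = m"
    by (intro div_nat_eqI) (simp_all add: mult.commute)
  have "(of_nat (p mod q) :: rat) = of_nat p - of_nat (q * m)"
    using m by (metis add_diff_cancel_left' mult_div_mod_eq of_nat_add)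
  also have "\<dots> = of_nat q * cfrac ms"
    unfolding p by (simp add: algebra_simps)
  finally have "p mod q = 0 \<longleftrightarrow> ms = []"
    using tail(3) \<open>0 < q\<close> by (metis less_numeral_extra(3) mult_eq_0_iff of_nat_eq_0_iff)
  moreover have "p mod q = 0 \<longleftrightarrow> q = 1"
    using \<open>coprime p q\<close> by (metis coprime_common_divisor dvd_refl nat_dvd_1_iff_1 mod_by_1
        mod_eq_0_iff_dvd)
  ultimately show "q = 1 \<longleftrightarrow> ms = []"
    by simp
qed

lemma begins_and_ends_with_symmetric:
  assumes "rev S = S" "S \<noteq> []" "hd S = x"
  shows "begins_and_ends_with S x"
  using assms by (metis begins_and_ends_with_def hd_rev)

theorem proposition4p5:
  fixes r :: rat and ms :: "nat list"
  assumes "0 < r" and "r \<le> 1"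
    and "admissible ms" and "r = cfrac ms"
  shows "\<exists>S1 S2 :: nat list.
    CS_rat r = cyc (S1 @ S2 @ S1 @ S2) \<and>
    (length ms = 1 \<longrightarrow> S1 = []) \<and>
    (rev S1 = S1 \<and> rev S2 = S2) \<and>
    ((length ms \<noteq> 1 \<longrightarrow> occurs_only_twice S1 (CS_rat r)) \<and> occurs_only_twice S2 (CS_rat r)) \<and>
    (length ms \<noteq> 1 \<longrightarrow> begins_and_ends_with S1 (hd ms + 1)) \<and>
    begins_and_ends_with S2 (hd ms)"
proof -
  obtain q' p' where quot: "quotient_of r = (q', p')"
    by fastforce
  define q p where "q = nat q'" and "p = nat p'"
  have "0 < p'" "r = of_int q' / of_int p'" "coprime q' p'"
    using quot quotient_of_denom_pos quotient_of_div quotient_of_coprime by auto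
  moreover from this have "0 < q'"
    using \<open>0 < r\<close> by (simp add: zero_less_divide_iff)
  ultimately have qp: "0 < q" "0 < p" "r = of_nat q / of_nat p" "coprime p q"
    by (simp_all add: q_def p_def coprime_commute flip: coprime_int_iff)
  have "q \<le> p"
    using \<open>r \<le> 1\<close> qp by simp
  then interpret coprime_fraction p q
    using qp by unfold_locales
  obtain m ms' where ms: "ms = m # ms'"
    using assms(3) by (cases ms) (auto simp: admissible_def)
  have m: "p div q = hd ms" and q1: "q = 1 \<longleftrightarrow> length ms = 1"
    using cfrac_quotient[of m ms' p q] assms(3,4) qp ms by auto
  obtain l where l: "l < q" "rounding l = int q - 1"
    by (rule obtain_rounding_max)
  define S1 S2 where "S1 = map gap [0..<l]" and "S2 = map gap [l..<q]"
  have CS: "CS_rat r = cyc (map gap [0..<2 * q])"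
    using CS_u_word by (simp add: CS_rat_def u_rat_def quot q_def p_def)
  have "CS_rat r = cyc (S1 @ S2 @ S1 @ S2)"
    using CS two_periods_eq[of l] l by (simp add: S1_def S2_def)
  moreover have "S1 = []" if "length ms = 1"
    using that q1 l by (simp add: S1_def)
  moreover have sym: "rev S1 = S1" "rev S2 = S2"
    using l unfolding S1_def S2_def by (intro gaps_symmetric; simp)+
  moreover have "occurs_only_twice S1 (CS_rat r)" "occurs_only_twice S2 (CS_rat r)"
    using l unfolding S1_def S2_def CS by (intro gaps_occur_only_twice; simp)+
  moreover have "begins_and_ends_with S1 (hd ms + 1)" if "length ms \<noteq> 1"
  proof (rule begins_and_ends_with_symmetric[OF sym(1)])
    have "l \<noteq> 0"
      using l q1 that by (auto intro: ccontr)
    then show "S1 \<noteq> []" "hd S1 = hd ms + 1"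
      using gap_0 q1 m that by (simp_all add: S1_def hd_map)
  qed
  moreover have "begins_and_ends_with S2 (hd ms)"
    using l gap_rounding_max m
    by (intro begins_and_ends_with_symmetric[OF sym(2)]) (simp_all add: S2_def hd_map)
  ultimately show ?thesis
    by blast
qed

end
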